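(* Let $\alpha_1, \alpha_2 \in [0,1]$ with $0<\alpha_1+\alpha_2<2$, let $(a_n)_{n \in \mathbb{N}}$, $(b_n)_{n \in \mathbb{N}}$ be two sequences in $[0,1]$, and let $\Omega$ be a convex subset of a Banach space $\mathbb{X}$. Then the optimal upper error bound (OUEB) sequence $(\mathcal{U}_n^{\mathrm{IM}})_{n \in \mathbb{N}}$ of the modified Ishikawa iterative process $$x_0\in\Omega,\qquad y_n=(1-a_n)x_n+a_nT_1(x_n),\qquad x_{n+1}=(1-b_n)y_n+b_nT_2(y_n),\quad n\in\mathbb{N},$$ is given by $$\mathcal{U}_n^{\mathrm{IM}} = \prod_{k=0}^n (1-a_k + \alpha_1 a_k)(1-b_k + \alpha_2 b_k), \quad n \in \mathbb{N}.$$ Moreover, $$\lim_{n \to \infty} \mathcal{U}_n^{\mathrm{IM}} = 0 \iff (1-\alpha_1)\sum_{k=0}^{\infty} a_k + (1-\alpha_2)\sum_{k=0}^{\infty} b_k = +\infty.$$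
   Context: Banach spaces are real; $\Omega$ is non-empty; $\mathbb{N}=\{0,1,2,\dots\}$. For $\alpha\in[0,1]$, $\mathbf{Ne}_{\alpha}(\Omega)$ is the set of maps $T:\Omega\to\Omega$ with $\|T(x)-T(y)\|\le\alpha\|x-y\|$ for all $x,y\in\Omega$. $\mathcal{F}(T_1,T_2)$ is the set of common fixed points, i.e. of $x^*\in\Omega$ with $T_1(x^* )=T_2(x^* )=x^*$. The process is considered for $T_1\in\mathbf{Ne}_{\alpha_1}(\Omega)$, $T_2\in\mathbf{Ne}_{\alpha_2}(\Omega)$ having a common fixed point. A non-negative sequence $(\mathcal{U}_n)_{n\in\mathbb{N}}$ is an upper error bound of the process if $\|x_{n+1}-x^*\|\le\mathcal{U}_n\|x_0-x^*\|$ for all $n\in\mathbb{N}$, for any pair $T_1\in\mathbf{Ne}_{\alpha_1}(\Omega)$, $T_2\in\mathbf{Ne}_{\alpha_2}(\Omega)$ with $x^*\in\mathcal{F}(T_1,T_2)$ and any initial point $x_0\in\Omega$. It is optimal (an OUEB) if moreover there exist $T_1\in\mathbf{Ne}_{\alpha_1}(\Omega)$, $T_2\in\mathbf{Ne}_{\alpha_2}(\Omega)$ and $x^*\in\mathcal{F}(T_1,T_2)$ such that $\|x_{n+1}-x^*\|=\mathcal{U}_n\|x_0-x^*\|$ for every $n\in\mathbb{N}$ and every $x_0\in\Omega$. Sums of non-negative terms take values in $[0,+\infty]$, with the convention $0\cdot(+\infty)=0$.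
   Formalization: That the limit being 0 implies the sum is +∞ is claimed only if no factor of the product vanishes (no k with α₁=0, a_k=1 or α₂=0, b_k=1); as printed it fails for α₁=0, α₂=1, a=(1,0,0,…), b=0. *)

theory Defs
  imports "HOL-Analysis.Analysis"
begin

text \<open>
  Self-maps of \<open>\<Omega>\<close> are represented by total functions on the ambient space; their values outside
  \<open>\<Omega>\<close> play no role.
\<close>

definition Ne :: "real \<Rightarrow> 'a::real_normed_vector set \<Rightarrow> ('a \<Rightarrow> 'a) set" where
  "Ne \<alpha> \<Omega> = {T. T \<in> \<Omega> \<rightarrow> \<Omega> \<and> (\<forall>x\<in>\<Omega>. \<forall>y\<in>\<Omega>. norm (T x - T y) \<le> \<alpha> * norm (x - y))}"

definition common_fixpoints :: "'a set \<Rightarrow> ('a \<Rightarrow> 'a) \<Rightarrow> ('a \<Rightarrow> 'a) \<Rightarrow> 'a set" where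
  "common_fixpoints \<Omega> T1 T2 = {x \<in> \<Omega>. T1 x = x \<and> T2 x = x}"

text \<open>
  An iterative process sends the pair \<open>T1, T2\<close> and the initial point \<open>x0\<close> to the sequence
  \<open>(x\<^sub>n)\<close>, whose term of index \<open>0\<close> is \<open>x0\<close>.
\<close>

type_synonym 'a process = "('a \<Rightarrow> 'a) \<Rightarrow> ('a \<Rightarrow> 'a) \<Rightarrow> 'a \<Rightarrow> nat \<Rightarrow> 'a"

definition upper_error_bound ::
    "real \<Rightarrow> real \<Rightarrow> 'a::real_normed_vector set \<Rightarrow> 'a process \<Rightarrow> (nat \<Rightarrow> real) \<Rightarrow> bool" where
  "upper_error_bound \<alpha>1 \<alpha>2 \<Omega> P U \<longleftrightarrow>
     (\<forall>n. 0 \<le> U n) \<and>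
     (\<forall>T1 \<in> Ne \<alpha>1 \<Omega>. \<forall>T2 \<in> Ne \<alpha>2 \<Omega>. \<forall>p \<in> common_fixpoints \<Omega> T1 T2. \<forall>x0 \<in> \<Omega>. \<forall>n.
        norm (P T1 T2 x0 (Suc n) - p) \<le> U n * norm (x0 - p))"

definition OUEB ::
    "real \<Rightarrow> real \<Rightarrow> 'a::real_normed_vector set \<Rightarrow> 'a process \<Rightarrow> (nat \<Rightarrow> real) \<Rightarrow> bool" where
  "OUEB \<alpha>1 \<alpha>2 \<Omega> P U \<longleftrightarrow>
     upper_error_bound \<alpha>1 \<alpha>2 \<Omega> P U \<and>
     (\<exists>T1 \<in> Ne \<alpha>1 \<Omega>. \<exists>T2 \<in> Ne \<alpha>2 \<Omega>. \<exists>p \<in> common_fixpoints \<Omega> T1 T2. \<forall>n. \<forall>x0 \<in> \<Omega>.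
        norm (P T1 T2 x0 (Suc n) - p) = U n * norm (x0 - p))"

primrec modified_Ishikawa ::
    "(nat \<Rightarrow> real) \<Rightarrow> (nat \<Rightarrow> real) \<Rightarrow> 'a::real_vector process" where
  "modified_Ishikawa a b T1 T2 x0 0 = x0"
| "modified_Ishikawa a b T1 T2 x0 (Suc n) =
     (let x = modified_Ishikawa a b T1 T2 x0 n;
          y = (1 - a n) *\<^sub>R x + a n *\<^sub>R T1 x
      in (1 - b n) *\<^sub>R y + b n *\<^sub>R T2 y)"

definition U_IM ::
    "real \<Rightarrow> real \<Rightarrow> (nat \<Rightarrow> real) \<Rightarrow> (nat \<Rightarrow> real) \<Rightarrow> nat \<Rightarrow> real" where
  "U_IM \<alpha>1 \<alpha>2 a b n =
     (\<Prod>k=0..n. (1 - a k + \<alpha>1 * a k) * (1 - b k + \<alpha>2 * b k))"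

text \<open>
  The sums are taken in \<^typ>\<open>ennreal\<close>, where \<open>0 * \<infinity> = 0\<close>.
\<close>

definition weighted_sum ::
    "real \<Rightarrow> real \<Rightarrow> (nat \<Rightarrow> real) \<Rightarrow> (nat \<Rightarrow> real) \<Rightarrow> ennreal" where
  "weighted_sum \<alpha>1 \<alpha>2 a b =
     ennreal (1 - \<alpha>1) * (\<Sum>k. ennreal (a k)) + ennreal (1 - \<alpha>2) * (\<Sum>k. ennreal (b k))"

text \<open>
  A factor of the product defining \<^const>\<open>U_IM\<close> vanishes exactly when \<open>\<alpha>1 = 0\<close> and \<open>a k = 1\<close>, or
  \<open>\<alpha>2 = 0\<close> and \<open>b k = 1\<close>. The product is then \<open>0\<close> from index \<open>k\<close> on, whatever the sums are, so
  convergence to \<open>0\<close> does not imply divergence of \<^const>\<open>weighted_sum\<close>. The hypotheses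
  \<open>0 < \<alpha>1 + \<alpha>2 < 2\<close> do not exclude this:
\<close>

lemma U_IM_vanishing_factor:
  fixes a b :: "nat \<Rightarrow> real"
  defines "a \<equiv> \<lambda>k. if k = 0 then 1 else 0" and "b \<equiv> \<lambda>k. 0"
  shows "U_IM 0 1 a b \<longlonglongrightarrow> 0" and "weighted_sum 0 1 a b \<noteq> \<infinity>"
proof -
  have "U_IM 0 1 a b = (\<lambda>n. 0)"
    by (auto simp: U_IM_def a_def b_def fun_eq_iff intro!: prod_zero bexI[of _ 0])
  then show "U_IM 0 1 a b \<longlonglongrightarrow> 0"
    by simp
  have "(\<Sum>k. ennreal (a k)) = (\<Sum>k\<in>{0}. ennreal (a k))"
    by (rule suminf_finite) (auto simp: a_def)
  then show "weighted_sum 0 1 a b \<noteq> \<infinity>"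
    by (simp add: weighted_sum_def a_def b_def)
qed

end

(* The homotheties T_i x = p + alpha_i (x - p) contract every step by exactly the factor that is a
   worst-case bound for arbitrary T_i, so the bound is attained. The limit criterion is the one for
   infinite products of factors in [0,1]: the product of (1 - t_k) tends to 0 when the series of the
   t_k diverges, and, if no factor vanishes, only then. *)
theory Submission
  imports Defs
begin

section \<open>The error estimate for one relaxed step and for the iteration\<close>

lemma NeD:
  assumes "T \<in> Ne \<alpha> \<Omega>" "x \<in> \<Omega>"
  shows Ne_mem: "T x \<in> \<Omega>"
    and Ne_norm: "y \<in> \<Omega> \<Longrightarrow> norm (T x - T y) \<le> \<alpha> * norm (x - y)"
  using assms by (auto simp: Ne_def)

lemma relaxation_mem:
  assumes "convex \<Omega>" "T \<in> Ne \<alpha> \<Omega>" "x \<in> \<Omega>" "t \<in> {0..1}"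
  shows "(1 - t) *\<^sub>R x + t *\<^sub>R T x \<in> \<Omega>"
  using assms(3,4) Ne_mem[OF assms(2,3)] by (intro convexD[OF assms(1)]) auto

text \<open>Since \<open>T p = p\<close>, the point \<open>p\<close> is the same convex combination
  of \<open>p\<close> and \<open>T p\<close> as the relaxed point is of \<open>x\<close> and
  \<open>T x\<close>. The triangle inequality then applies term by term.\<close>

lemma relaxation_norm_le:
  assumes "T \<in> Ne \<alpha> \<Omega>" "x \<in> \<Omega>" "p \<in> \<Omega>" "T p = p" "t \<in> {0..1}"
  shows "norm ((1 - t) *\<^sub>R x + t *\<^sub>R T x - p) \<le> (1 - t + \<alpha> * t) * norm (x - p)"
proof -
  have "(1 - t) *\<^sub>R x + t *\<^sub>R T x - p = (1 - t) *\<^sub>R (x - p) + t *\<^sub>R (T x - T p)"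
    using assms(4) by (simp add: algebra_simps)
  also have "norm \<dots> \<le> (1 - t) * norm (x - p) + t * norm (T x - T p)"
    using assms(5) by (intro norm_triangle_le) simp
  also have "\<dots> \<le> (1 - t) * norm (x - p) + t * (\<alpha> * norm (x - p))"
    using assms by (intro add_left_mono mult_left_mono Ne_norm) auto
  finally show ?thesis by (simp add: algebra_simps)
qed

lemma relaxation_factor_nonneg:
  fixes \<alpha> t :: real
  assumes "\<alpha> \<in> {0..1}" "t \<in> {0..1}"
  shows "0 \<le> 1 - t + \<alpha> * t"
  using assms by (intro add_nonneg_nonneg mult_nonneg_nonneg) auto

text \<open>The new factors stand outside, with that of \<open>T2\<close> outermost, as in one
  iteration, so that the inductions can chain their estimates directly.\<close>

lemma U_IM_Suc:
  "U_IM \<alpha>1 \<alpha>2 a b (Suc n) =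
     (1 - b (Suc n) + \<alpha>2 * b (Suc n)) * ((1 - a (Suc n) + \<alpha>1 * a (Suc n)) * U_IM \<alpha>1 \<alpha>2 a b n)"
  by (simp add: U_IM_def mult_ac)

lemma U_IM_nonneg:
  assumes "\<alpha>1 \<in> {0..1}" "\<alpha>2 \<in> {0..1}" "\<And>n. a n \<in> {0..1}" "\<And>n. b n \<in> {0..1}"
  shows "0 \<le> U_IM \<alpha>1 \<alpha>2 a b n"
  unfolding U_IM_def
  by (intro prod_nonneg ballI mult_nonneg_nonneg relaxation_factor_nonneg assms)

text \<open>Convexity keeps the iterates in \<open>\<Omega>\<close>, the only place where membership
  in \<open>Ne\<close> controls the maps.\<close>

lemma modified_Ishikawa_mem:
  assumes "convex \<Omega>" "T1 \<in> Ne \<alpha>1 \<Omega>" "T2 \<in> Ne \<alpha>2 \<Omega>" "x0 \<in> \<Omega>"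
    and "\<And>n. a n \<in> {0..1}" "\<And>n. b n \<in> {0..1}"
  shows "modified_Ishikawa a b T1 T2 x0 n \<in> \<Omega>"
proof (induction n)
  case (Suc n)
  show ?case
    unfolding modified_Ishikawa.simps Let_def
    by (intro relaxation_mem[OF _ assms(2)] relaxation_mem[OF _ assms(3)] Suc assms)
qed (simp add: assms)

lemma upper_error_bound_U_IM:
  assumes \<alpha>: "\<alpha>1 \<in> {0..1}" "\<alpha>2 \<in> {0..1}"
    and ab: "\<And>n. a n \<in> {0..1}" "\<And>n. b n \<in> {0..1}" and "convex \<Omega>"
  shows "upper_error_bound \<alpha>1 \<alpha>2 \<Omega> (modified_Ishikawa a b) (U_IM \<alpha>1 \<alpha>2 a b)"
  unfolding upper_error_bound_def
proof (intro conjI allI ballI)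
  show "0 \<le> U_IM \<alpha>1 \<alpha>2 a b n" for n
    using assms by (intro U_IM_nonneg)
next
  fix T1 T2 p x0 n
  assume T: "T1 \<in> Ne \<alpha>1 \<Omega>" "T2 \<in> Ne \<alpha>2 \<Omega>"
    and "p \<in> common_fixpoints \<Omega> T1 T2" and x0: "x0 \<in> \<Omega>"
  then have p: "p \<in> \<Omega>" "T1 p = p" "T2 p = p" by (auto simp: common_fixpoints_def)
  define x where "x = modified_Ishikawa a b T1 T2 x0"
  have step: "norm (x (Suc n) - p) \<le>
      (1 - b n + \<alpha>2 * b n) * ((1 - a n + \<alpha>1 * a n) * norm (x n - p))" for n
  proof -
    define y where "y = (1 - a n) *\<^sub>R x n + a n *\<^sub>R T1 (x n)"
    have xn: "x n \<in> \<Omega>"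
      unfolding x_def using assms T x0 by (intro modified_Ishikawa_mem)
    have y: "y \<in> \<Omega>"
      unfolding y_def using assms T xn by (intro relaxation_mem)
    have "norm (x (Suc n) - p) \<le> (1 - b n + \<alpha>2 * b n) * norm (y - p)"
      using relaxation_norm_le[OF T(2) y p(1,3) ab(2)] by (simp add: x_def y_def Let_def)
    also have "\<dots> \<le> (1 - b n + \<alpha>2 * b n) * ((1 - a n + \<alpha>1 * a n) * norm (x n - p))"
      unfolding y_def
      using relaxation_norm_le[OF T(1) xn p(1,2) ab(1)] \<alpha> ab
      by (intro mult_left_mono relaxation_factor_nonneg)
    finally show ?thesis .
  qed
  \<comment> \<open>The bound of index \<open>n\<close> concerns the iterate of index
    \<open>Suc n\<close>, so the base case is already a full iteration.\<close>
  have "norm (x (Suc n) - p) \<le> U_IM \<alpha>1 \<alpha>2 a b n * norm (x0 - p)"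
  proof (induction n)
    case 0
    then show ?case using step[of 0] by (simp add: U_IM_def x_def mult_ac del: modified_Ishikawa.simps(2))
  next
    case (Suc n)
    note step[of "Suc n"]
    also have "(1 - b (Suc n) + \<alpha>2 * b (Suc n)) *
          ((1 - a (Suc n) + \<alpha>1 * a (Suc n)) * norm (x (Suc n) - p)) \<le>
        (1 - b (Suc n) + \<alpha>2 * b (Suc n)) *
          ((1 - a (Suc n) + \<alpha>1 * a (Suc n)) * (U_IM \<alpha>1 \<alpha>2 a b n * norm (x0 - p)))"
      using Suc \<alpha> ab by (intro mult_left_mono relaxation_factor_nonneg)
    finally show ?case by (simp add: U_IM_Suc mult.assoc)
  qed
  then show "norm (modified_Ishikawa a b T1 T2 x0 (Suc n) - p) \<le>
      U_IM \<alpha>1 \<alpha>2 a b n * norm (x0 - p)"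
    by (simp only: x_def)
qed

section \<open>Homotheties attain the bound\<close>

text \<open>The image of \<open>x\<close> lies on the segment from \<open>p\<close> to
  \<open>x\<close>, hence in \<open>\<Omega>\<close> by convexity, and distances are scaled by
  exactly \<open>\<alpha>\<close>.\<close>

lemma homothety_in_Ne:
  assumes "convex \<Omega>" "p \<in> \<Omega>" "\<alpha> \<in> {0..1}"
  shows "(\<lambda>x. p + \<alpha> *\<^sub>R (x - p)) \<in> Ne \<alpha> \<Omega>"
proof -
  have "p + \<alpha> *\<^sub>R (x - p) \<in> \<Omega>" if "x \<in> \<Omega>" for x
    using convexD_alt[OF assms(1,2) that, of \<alpha>] assms(3) by (simp add: algebra_simps)
  moreover have "norm ((p + \<alpha> *\<^sub>R (x - p)) - (p + \<alpha> *\<^sub>R (y - p))) = \<alpha> * norm (x - y)" for x y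
    using assms(3) by (simp flip: scaleR_diff_right)
  ultimately show ?thesis by (auto simp: Ne_def)
qed

lemma relaxed_homothety:
  fixes x p :: "'a::real_vector"
  shows "(1 - t) *\<^sub>R x + t *\<^sub>R (p + \<alpha> *\<^sub>R (x - p)) - p = (1 - t + \<alpha> * t) *\<^sub>R (x - p)"
  by (simp add: algebra_simps)

text \<open>Relaxing a homothety gives a homothety with the same centre, and such maps compose by
  multiplying their ratios. This yields an identity of vectors; the sign of \<open>U_IM\<close>
  matters only once norms are taken.\<close>

lemma modified_Ishikawa_homothety:
  fixes x0 p :: "'a::real_vector"
  shows "modified_Ishikawa a b (\<lambda>x. p + \<alpha>1 *\<^sub>R (x - p)) (\<lambda>x. p + \<alpha>2 *\<^sub>R (x - p)) x0 (Suc n) - p =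
    U_IM \<alpha>1 \<alpha>2 a b n *\<^sub>R (x0 - p)"
proof -
  define x where "x = modified_Ishikawa a b (\<lambda>x. p + \<alpha>1 *\<^sub>R (x - p)) (\<lambda>x. p + \<alpha>2 *\<^sub>R (x - p)) x0"
  have step: "x (Suc n) - p =
      ((1 - b n + \<alpha>2 * b n) * (1 - a n + \<alpha>1 * a n)) *\<^sub>R (x n - p)" for n
  proof -
    define y where "y = (1 - a n) *\<^sub>R x n + a n *\<^sub>R (p + \<alpha>1 *\<^sub>R (x n - p))"
    have "x (Suc n) = (1 - b n) *\<^sub>R y + b n *\<^sub>R (p + \<alpha>2 *\<^sub>R (y - p))"
      by (simp only: x_def y_def modified_Ishikawa.simps Let_def)
    then have "x (Suc n) - p = (1 - b n + \<alpha>2 * b n) *\<^sub>R (y - p)"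
      by (simp only: relaxed_homothety)
    also have "y - p = (1 - a n + \<alpha>1 * a n) *\<^sub>R (x n - p)"
      by (simp only: y_def relaxed_homothety)
    finally show ?thesis by simp
  qed
  have "x (Suc n) - p = U_IM \<alpha>1 \<alpha>2 a b n *\<^sub>R (x0 - p)"
  proof (induction n)
    case 0
    have "x 0 = x0" by (simp add: x_def)
    then show ?case by (simp add: step U_IM_def mult.commute)
  next
    case (Suc n)
    then show ?case by (simp add: step[of "Suc n"] U_IM_Suc mult.assoc)
  qed
  then show ?thesis by (simp only: x_def)
qed

lemma OUEB_U_IM:
  fixes \<Omega> :: "'a::real_normed_vector set"
  assumes "\<alpha>1 \<in> {0..1}" "\<alpha>2 \<in> {0..1}" "\<And>n. a n \<in> {0..1}" "\<And>n. b n \<in> {0..1}"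
    and "convex \<Omega>" "\<Omega> \<noteq> {}"
  shows "OUEB \<alpha>1 \<alpha>2 \<Omega> (modified_Ishikawa a b) (U_IM \<alpha>1 \<alpha>2 a b)"
proof -
  \<comment> \<open>Any point can be the centre, but both homotheties must share it, so that it is a
    common fixed point.\<close>
  obtain p where p: "p \<in> \<Omega>" using assms(6) by blast
  define H where "H = (\<lambda>\<alpha> x. p + \<alpha> *\<^sub>R (x - p))"
  have "H \<alpha>1 \<in> Ne \<alpha>1 \<Omega>" "H \<alpha>2 \<in> Ne \<alpha>2 \<Omega>"
    unfolding H_def by (intro homothety_in_Ne assms p)+
  moreover have "p \<in> common_fixpoints \<Omega> (H \<alpha>1) (H \<alpha>2)"
    using p by (simp add: common_fixpoints_def H_def)
  moreover have "norm (modified_Ishikawa a b (H \<alpha>1) (H \<alpha>2) x0 (Suc n) - p) =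
      U_IM \<alpha>1 \<alpha>2 a b n * norm (x0 - p)" for x0 n
    unfolding H_def modified_Ishikawa_homothety using U_IM_nonneg[of \<alpha>1 \<alpha>2 a b n] assms by simp
  ultimately show ?thesis
    unfolding OUEB_def using upper_error_bound_U_IM assms by blast
qed

section \<open>Uniqueness of the optimal bound\<close>

text \<open>The pair of maps that attains \<open>U\<close> is also a test case for \<open>V\<close>.
  A starting point other than \<open>p\<close> allows the positive norm to be cancelled.\<close>

lemma OUEB_le:
  assumes "\<not> is_singleton \<Omega>"
    and "OUEB \<alpha>1 \<alpha>2 \<Omega> P U" and "upper_error_bound \<alpha>1 \<alpha>2 \<Omega> P V"
  shows "U n \<le> V n"
proof -
  from assms(2) obtain T1 T2 p where T: "T1 \<in> Ne \<alpha>1 \<Omega>" "T2 \<in> Ne \<alpha>2 \<Omega>"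
      "p \<in> common_fixpoints \<Omega> T1 T2"
    and eq: "\<And>n x0. x0 \<in> \<Omega> \<Longrightarrow> norm (P T1 T2 x0 (Suc n) - p) = U n * norm (x0 - p)"
    unfolding OUEB_def by blast
  have "p \<in> \<Omega>" using T(3) by (simp add: common_fixpoints_def)
  then obtain x0 where x0: "x0 \<in> \<Omega>" "x0 \<noteq> p"
    using assms(1) by (force simp: is_singleton_def)
  have "U n * norm (x0 - p) \<le> V n * norm (x0 - p)"
    using assms(3) T x0(1) eq unfolding upper_error_bound_def by metis
  then show ?thesis using x0(2) by simp
qed

lemma OUEB_unique:
  assumes "\<not> is_singleton \<Omega>" "OUEB \<alpha>1 \<alpha>2 \<Omega> P U" "OUEB \<alpha>1 \<alpha>2 \<Omega> P V"
  shows "U = V"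
proof (intro ext antisym)
  have "upper_error_bound \<alpha>1 \<alpha>2 \<Omega> P U" "upper_error_bound \<alpha>1 \<alpha>2 \<Omega> P V"
    using assms(2,3) by (simp_all add: OUEB_def)
  then show "U n \<le> V n" "V n \<le> U n" for n
    using OUEB_le[OF assms(1)] assms(2,3) by blast+
qed

section \<open>Infinite products and series\<close>

text \<open>By \<open>1 - t \<le> exp (- t)\<close>, the products lie between 0 and the exponential
  of the negated partial sums, which grow without bound.\<close>

lemma prod_tendsto_0_if_not_summable:
  fixes t :: "nat \<Rightarrow> real"
  assumes t: "\<And>k. t k \<in> {0..1}" and "\<not> summable t"
  shows "(\<lambda>n. \<Prod>k\<le>n. 1 - t k) \<longlonglongrightarrow> 0"
proof (rule tendsto_sandwich[OF _ _ tendsto_const])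
  have "\<exists>N. \<forall>n\<ge>N. Z \<le> (\<Sum>k\<le>n. t k)" for Z
  proof -
    have "\<not> (\<forall>n. (\<Sum>k\<le>n. t k) \<le> Z)"
      using bounded_imp_summable[of t Z] t assms(2) by auto
    then obtain N where "Z < (\<Sum>k\<le>N. t k)" by (auto simp: not_le)
    moreover have "(\<Sum>k\<le>N. t k) \<le> (\<Sum>k\<le>n. t k)" if "n \<ge> N" for n
      using t that by (intro sum_mono2) auto
    ultimately show ?thesis by (metis less_le_trans less_imp_le)
  qed
  then have "filterlim (\<lambda>n. \<Sum>k\<le>n. t k) at_top sequentially"
    by (simp add: filterlim_at_top eventually_sequentially)
  then show "(\<lambda>n. exp (- (\<Sum>k\<le>n. t k))) \<longlonglongrightarrow> 0"
    by (intro filterlim_compose[OF exp_at_bot]) (simp add: filterlim_uminus_at_top)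
  have "(\<Prod>k\<le>n. 1 - t k) \<le> exp (- (\<Sum>k\<le>n. t k))" for n
  proof -
    have "(\<Prod>k\<le>n. 1 - t k) \<le> (\<Prod>k\<le>n. exp (- t k))"
      using t exp_ge_add_one_self[of "- t _"] by (intro prod_mono) (auto simp del: exp_ge_add_one_self)
    then show ?thesis by (simp add: exp_sum flip: sum_negf)
  qed
  then show "\<forall>\<^sub>F n in sequentially. (\<Prod>k\<le>n. 1 - t k) \<le> exp (- (\<Sum>k\<le>n. t k))"
    by simp
  show "\<forall>\<^sub>F n in sequentially. 0 \<le> (\<Prod>k\<le>n. 1 - t k)"
    using t by (auto intro!: always_eventually prod_nonneg)
qed

text \<open>Summability makes the product converge in the sense of \<open>convergent_prod\<close>,
  where the limit is non-zero after dropping finitely many factors. As no factor is 0, the full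
  product is non-zero as well.\<close>

lemma prod_not_tendsto_0_if_summable:
  fixes t :: "nat \<Rightarrow> real"
  assumes "\<And>k. t k \<ge> 0" "\<And>k. t k \<noteq> 1" "summable t"
  shows "\<not> (\<lambda>n. \<Prod>k\<le>n. 1 - t k) \<longlonglongrightarrow> 0"
proof
  assume lim: "(\<lambda>n. \<Prod>k\<le>n. 1 - t k) \<longlonglongrightarrow> 0"
  have conv: "convergent_prod (\<lambda>k. 1 - t k)"
    using assms by (intro abs_convergent_prod_imp_convergent_prod summable_imp_abs_convergent_prod) simp
  then have "prodinf (\<lambda>k. 1 - t k) = 0"
    using LIMSEQ_unique[OF convergent_prod_LIMSEQ lim] by simp
  with prodinf_nonzero[OF conv] assms(2) show False by auto
qed

text \<open>Moving \<open>r\<close> inside the series accounts for the convention on 0 times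
  infinity: for \<open>r = 0\<close> the left product is 0 and the real series is the zero
  series.\<close>

lemma mult_suminf_ennreal_eq_top_iff:
  assumes "r \<ge> 0" "\<And>k. f k \<ge> 0"
  shows "ennreal r * (\<Sum>k. ennreal (f k)) = top \<longleftrightarrow> \<not> summable (\<lambda>k. r * f k)"
proof -
  have nn: "r * f k \<ge> 0" for k using assms by simp
  have "ennreal r * (\<Sum>k. ennreal (f k)) = (\<Sum>k. ennreal (r * f k))"
    using assms by (simp add: ennreal_mult)
  then show ?thesis
    using summable_suminf_not_top[of "\<lambda>k. r * f k", OF nn]
      ennreal_suminf_neq_top[of "\<lambda>k. r * f k", OF _ nn] by argo
qed

lemma weighted_sum_eq_top_iff:
  assumes "\<alpha>1 \<le> 1" "\<alpha>2 \<le> 1" "\<And>k. a k \<ge> 0" "\<And>k. b k \<ge> 0"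
  shows "weighted_sum \<alpha>1 \<alpha>2 a b = \<infinity> \<longleftrightarrow>
    \<not> (summable (\<lambda>k. (1 - \<alpha>1) * a k) \<and> summable (\<lambda>k. (1 - \<alpha>2) * b k))"
proof -
  have nn: "1 - \<alpha>1 \<ge> 0" "1 - \<alpha>2 \<ge> 0" using assms by auto
  show ?thesis
    unfolding weighted_sum_def infinity_ennreal_def ennreal_add_eq_top
      mult_suminf_ennreal_eq_top_iff[of "1 - \<alpha>1" a, OF nn(1) assms(3)]
      mult_suminf_ennreal_eq_top_iff[of "1 - \<alpha>2" b, OF nn(2) assms(4)]
    by blast
qed

text \<open>The term is the probability of a union of independent events with probabilities
  \<open>c k\<close> and \<open>d k\<close>. It lies above each of them and below their sum, so
  comparison works in both directions.\<close>

lemma summable_union_probability_iff: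
  fixes c d :: "nat \<Rightarrow> real"
  assumes c: "\<And>k. c k \<in> {0..1}" and d: "\<And>k. d k \<in> {0..1}"
  shows "summable (\<lambda>k. 1 - (1 - c k) * (1 - d k)) \<longleftrightarrow> summable c \<and> summable d"
proof -
  have le: "0 \<le> c k" "0 \<le> d k" "c k \<le> 1 - (1 - c k) * (1 - d k)" "d k \<le> 1 - (1 - c k) * (1 - d k)"
    "1 - (1 - c k) * (1 - d k) \<le> c k + d k" for k
    \<comment> \<open>The differences in the last three inequalities are
      \<open>d k * (1 - c k)\<close>, \<open>c k * (1 - d k)\<close> and
      \<open>c k * d k\<close>.\<close>
    using c[of k] d[of k] mult_nonneg_nonneg[of "c k" "1 - d k"] mult_nonneg_nonneg[of "d k" "1 - c k"]
      mult_nonneg_nonneg[of "c k" "d k"]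
    by (auto simp: algebra_simps)
  show ?thesis
  proof (intro iffI conjI; (elim conjE)?)
    assume s: "summable (\<lambda>k. 1 - (1 - c k) * (1 - d k))"
    show "summable c"
      by (rule summable_comparison_test'[OF s, of 0]) (simp only: real_norm_def abs_of_nonneg le)
    show "summable d"
      by (rule summable_comparison_test'[OF s, of 0]) (simp only: real_norm_def abs_of_nonneg le)
  next
    assume "summable c" "summable d"
    from summable_add[OF this] show "summable (\<lambda>k. 1 - (1 - c k) * (1 - d k))"
      by (rule summable_comparison_test'[of _ 0])
        (simp only: real_norm_def abs_of_nonneg order_trans[OF le(1,3)] le)
  qed
qed


text \<open>Uniqueness is asserted when \<open>\<Omega>\<close> is not a single point, since on a
  single point every non-negative sequence is optimal. The limit criterion is split: divergence
  always forces the limit 0, while the converse fails when a factor vanishes, as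
  \<open>U_IM_vanishing_factor\<close> shows.\<close>

theorem theorem3p4:
  fixes \<alpha>1 \<alpha>2 :: real
    and a b :: "nat \<Rightarrow> real"
    and \<Omega> :: "'a::banach set"
  assumes "\<alpha>1 \<in> {0..1}" and "\<alpha>2 \<in> {0..1}"
    and "0 < \<alpha>1 + \<alpha>2" and "\<alpha>1 + \<alpha>2 < 2"
    and "\<And>n. a n \<in> {0..1}" and "\<And>n. b n \<in> {0..1}"
    and "convex \<Omega>" and "\<Omega> \<noteq> {}"
  shows "OUEB \<alpha>1 \<alpha>2 \<Omega> (modified_Ishikawa a b) (U_IM \<alpha>1 \<alpha>2 a b) \<and>
         (\<not> is_singleton \<Omega> \<longrightarrow>
           (\<forall>V. OUEB \<alpha>1 \<alpha>2 \<Omega> (modified_Ishikawa a b) V \<longrightarrow> V = U_IM \<alpha>1 \<alpha>2 a b)) \<and>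
         (weighted_sum \<alpha>1 \<alpha>2 a b = \<infinity> \<longrightarrow> U_IM \<alpha>1 \<alpha>2 a b \<longlonglongrightarrow> 0) \<and>
         ((\<forall>k. \<not> (\<alpha>1 = 0 \<and> a k = 1) \<and> \<not> (\<alpha>2 = 0 \<and> b k = 1)) \<longrightarrow>
           (U_IM \<alpha>1 \<alpha>2 a b \<longlonglongrightarrow> 0 \<longleftrightarrow> weighted_sum \<alpha>1 \<alpha>2 a b = \<infinity>))"
proof (intro conjI impI allI)
  show O: "OUEB \<alpha>1 \<alpha>2 \<Omega> (modified_Ishikawa a b) (U_IM \<alpha>1 \<alpha>2 a b)"
    using assms by (intro OUEB_U_IM)
  show "V = U_IM \<alpha>1 \<alpha>2 a b"
    if "\<not> is_singleton \<Omega>" "OUEB \<alpha>1 \<alpha>2 \<Omega> (modified_Ishikawa a b) V" for V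
    using OUEB_unique[OF that O] .
  \<comment> \<open>\<open>c k\<close> and \<open>d k\<close> are the amounts by which the two
    factors of index \<open>k\<close> fall short of 1, and \<open>t k\<close> is the same for their
    product.\<close>
  define c d where "c = (\<lambda>k. (1 - \<alpha>1) * a k)" and "d = (\<lambda>k. (1 - \<alpha>2) * b k)"
  define t where "t = (\<lambda>k. 1 - (1 - c k) * (1 - d k))"
  have c: "c k \<in> {0..1}" and d: "d k \<in> {0..1}" for k
    using assms(1,2,5,6) by (auto simp: c_def d_def intro!: mult_le_one)
  have t: "t k \<in> {0..1}" for k
    using c[of k] d[of k] by (auto simp: t_def intro!: mult_le_one)
  have U: "U_IM \<alpha>1 \<alpha>2 a b = (\<lambda>n. \<Prod>k\<le>n. 1 - t k)"
    by (simp add: fun_eq_iff U_IM_def t_def c_def d_def atMost_atLeast0 algebra_simps)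
  have w: "weighted_sum \<alpha>1 \<alpha>2 a b = \<infinity> \<longleftrightarrow> \<not> summable t"
    unfolding t_def summable_union_probability_iff[of c d, OF c d]
    unfolding c_def d_def
    using assms(1,2,5,6) by (intro weighted_sum_eq_top_iff) auto
  show lim: "U_IM \<alpha>1 \<alpha>2 a b \<longlonglongrightarrow> 0" if "weighted_sum \<alpha>1 \<alpha>2 a b = \<infinity>"
    using that prod_tendsto_0_if_not_summable[of t, OF t] unfolding w U by blast
  \<comment> \<open>A product of two numbers in [0,1] equals 1 only if both do, so
    \<open>t k = 1\<close> happens only in the cases that \<open>nz\<close> excludes.\<close>
  have c_neq: "(1 - \<alpha>) * s \<noteq> 1" if "\<alpha> \<in> {0..1}" "s \<in> {0..1}" "\<not> (\<alpha> = 0 \<and> s = 1)" for \<alpha> s :: real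
  proof
    assume "(1 - \<alpha>) * s = 1"
    moreover have "(1 - \<alpha>) * s \<le> 1 - \<alpha>" "(1 - \<alpha>) * s \<le> s"
      using that by (auto intro: mult_left_le mult_left_le_one_le)
    ultimately show False using that by auto
  qed
  assume nz: "\<forall>k. \<not> (\<alpha>1 = 0 \<and> a k = 1) \<and> \<not> (\<alpha>2 = 0 \<and> b k = 1)"
  have "t k \<noteq> 1" for k
    using c_neq[OF assms(1,5)] c_neq[OF assms(2,6)] nz by (auto simp: t_def c_def d_def)
  then show "U_IM \<alpha>1 \<alpha>2 a b \<longlonglongrightarrow> 0 \<longleftrightarrow> weighted_sum \<alpha>1 \<alpha>2 a b = \<infinity>"
    using prod_not_tendsto_0_if_summable[of t] t lim unfolding w U by fastforce
qed

end
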